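(* Let $F$ be an Orlicz function satisfying the $\Delta_2$-condition, and put $F_t(x)=F(tx)/F(t)$. The following conditions on $F$ are equivalent: (1) $F$ is elastic at $\infty$. (2) There exist constants $C_0,C_1>1$ such that if $1\le a_1<b_1\le\cdots\le a_n<b_n$ and $0\le x\le1$ then $\sum_{k=1}^n(F_{b_k}(x)-C_0F_{a_k}(x))\le C_1$. (3) There exist constants $C_0,C_1>1$ such that if $1\le a_1<b_1\le\cdots\le a_n<b_n$ and $0\le x\le1$ then $\sum_{k=1}^n(F_{a_k}(x)-C_0F_{b_k}(x))\le C_1$. (4) There exist a bounded monotone increasing function $w:[1,\infty)\to\mathbb R$ and a constant $C_0$ such that if $1\le s\le t$ and $0\le x\le1$ then $F_t(x)\le C_0F_s(x)+w(t)-w(s)$. (5) There exist a bounded monotone increasing function $w:[1,\infty)\to\mathbb R$ and a constant $C_0$ such that if $1\le s\le t$ and $0\le x\le1$ then $F_s(x)\le C_0F_t(x)+w(t)-w(s)$.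
   Context: An Orlicz function is a continuous strictly increasing convex function $F:[0,\infty)\to[0,\infty)$ with $F(0)=0$. It satisfies the $\Delta_2$-condition if there is a constant $\Delta$ with $F(2x)\le\Delta F(x)$ for all $x\ge0$. For $t>0$ put $F_t(x)=F(tx)/F(t)$. For $C>1$ and $0<x\le1$, let $\Phi_+^\infty(x,C)$ be the supremum of all $n$ such that there exist $1\le a_1<b_1\le a_2<b_2\le\cdots\le a_n<b_n$ with $F_{b_k}(x)\ge CF_{a_k}(x)$ for $1\le k\le n$; let $\Phi_-^\infty(x,C)$ be the supremum of all $n$ such that there exist $1\le a_1<b_1\le\cdots\le a_n<b_n$ with $F_{a_k}(x)\ge CF_{b_k}(x)$ for $1\le k\le n$. $F$ is elastic at $\infty$ if there exist $C_0,C_1>1$ and $r>0$ such that $\Phi_+^\infty(x,C_0)+\Phi_-^\infty(x,C_0)\le C_1x^{-r}$ for all $0<x\le1$. *)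

theory Defs
  imports "HOL-Analysis.Analysis"
begin

text \<open>Functions on \<open>[0,\<infinity>)\<close> are represented by total functions on the reals, of which only the
  values at non-negative arguments matter.\<close>

definition orlicz_function :: "(real \<Rightarrow> real) \<Rightarrow> bool" where
  "orlicz_function F \<longleftrightarrow>
     F \<in> {0..} \<rightarrow> {0..} \<and> continuous_on {0..} F \<and> strict_mono_on {0..} F \<and>
     convex_on {0..} F \<and> F 0 = 0"

definition Delta2_condition :: "(real \<Rightarrow> real) \<Rightarrow> bool" where
  "Delta2_condition F \<longleftrightarrow> (\<exists>\<Delta>. \<forall>x\<ge>0. F (2 * x) \<le> \<Delta> * F x)"

definition dilate :: "(real \<Rightarrow> real) \<Rightarrow> real \<Rightarrow> real \<Rightarrow> real" where
  "dilate F t x = F (t * x) / F t"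

text \<open>\<open>1 \<le> a 1 < b 1 \<le> a 2 < b 2 \<le> \<dots> \<le> a n < b n\<close>; only the indices \<open>1..n\<close> matter, and
  \<open>n = 0\<close> is the empty chain.\<close>

definition interlaced :: "nat \<Rightarrow> (nat \<Rightarrow> real) \<Rightarrow> (nat \<Rightarrow> real) \<Rightarrow> bool" where
  "interlaced n a b \<longleftrightarrow>
     (\<forall>k\<in>{1..n}. 1 \<le> a k \<and> a k < b k) \<and> (\<forall>k\<in>{1..<n}. b k \<le> a (Suc k))"

definition Phi_plus_inf :: "(real \<Rightarrow> real) \<Rightarrow> real \<Rightarrow> real \<Rightarrow> enat" where
  "Phi_plus_inf F x C =
     Sup {enat n | n. \<exists>a b. interlaced n a b \<and>
       (\<forall>k\<in>{1..n}. dilate F (b k) x \<ge> C * dilate F (a k) x)}"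

definition Phi_minus_inf :: "(real \<Rightarrow> real) \<Rightarrow> real \<Rightarrow> real \<Rightarrow> enat" where
  "Phi_minus_inf F x C =
     Sup {enat n | n. \<exists>a b. interlaced n a b \<and>
       (\<forall>k\<in>{1..n}. dilate F (a k) x \<ge> C * dilate F (b k) x)}"

definition elastic_at_infinity :: "(real \<Rightarrow> real) \<Rightarrow> bool" where
  "elastic_at_infinity F \<longleftrightarrow>
     (\<exists>C0 C1 r. C0 > 1 \<and> C1 > 1 \<and> r > 0 \<and>
       (\<forall>x. 0 < x \<and> x \<le> 1 \<longrightarrow>
         ereal_of_enat (Phi_plus_inf F x C0 + Phi_minus_inf F x C0) \<le> ereal (C1 * x powr (- r))))"

end

theory Submission
  imports Defs
begin

text \<open>The implication from (1) to (4) and (5) rests on \<open>F_t(x ^ m) = \<Prod>i<m. F_{t x ^ i}(x)\<close>: passing from \<open>x\<close>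
  to \<open>x ^ m\<close> and from \<open>C\<close> to \<open>C ^ m\<close> divides the exponent in a bound \<open>O(x powr - r)\<close> of the jump counts
  by \<open>m\<close>. Once the exponent is below 1, \<open>\<Sum>y. y * N(y)\<close> converges along \<open>y = 2 ^ (- m * j)\<close>, where \<open>N(y)\<close>
  counts the jumps of \<open>F_t(y)\<close>, and counting only jumps before \<open>t\<close> turns this sum into the function \<open>w\<close>.
  As \<open>F_t(x) \<le> x\<close>, the potential \<open>w\<close> pays for every jump at \<open>x\<close>. (4) and (5) telescope to (2) and (3). As
  \<open>F_t(x)\<close> is bounded below by a power of \<open>x\<close>, each of (2) and (3) bounds one of the two jump counts,
  and since \<open>ln (F_t(x))\<close> has logarithmic range, either count controls the other.\<close>

section \<open>Chains of jumps\<close>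

text \<open>For positive \<open>g\<close>, falls are rises of the reciprocal, so one notion covers
  both counts in the definition of elasticity. Keeping the length \<open>n\<close> explicit allows
  bounds to be real inequalities instead of suprema in \<open>enat\<close>.\<close>

definition rises :: "real \<Rightarrow> (real \<Rightarrow> real) \<Rightarrow> nat \<Rightarrow> bool" where
  "rises C g n \<longleftrightarrow> (\<exists>a b. interlaced n a b \<and> (\<forall>k\<in>{1..n}. C * g (a k) \<le> g (b k)))"

lemma interlaced_le:
  assumes "interlaced n a b" "1 \<le> k" "k < l" "l \<le> n"
  shows "b k \<le> a l"
  using \<open>k < l\<close> \<open>l \<le> n\<close>
proof (induction l)
  case (Suc l)
  show ?case
  proof (cases "k = l")
    case True
    then show ?thesis using assms(1,2) Suc.prems by (auto simp: interlaced_def)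
  next
    case False
    then have "b k \<le> a l" using Suc by simp
    also have "a l < b l" using assms(1,2) Suc.prems False by (auto simp: interlaced_def)
    also have "b l \<le> a (Suc l)" using assms(1,2) Suc.prems False by (auto simp: interlaced_def)
    finally show ?thesis by simp
  qed
qed simp

text \<open>Sorting \<open>S\<close> renumbers it as an initial segment, the only index set that
  \<open>interlaced\<close> admits. The order hypothesis concerns all pairs \<open>k < l\<close>,
  since neighbours in \<open>S\<close> need not be consecutive numbers.\<close>

lemma interlaced_subchain:
  fixes S :: "nat set"
  assumes "finite S"
    and "\<And>k. k \<in> S \<Longrightarrow> 1 \<le> a k \<and> a k < b k"
    and "\<And>k l. k \<in> S \<Longrightarrow> l \<in> S \<Longrightarrow> k < l \<Longrightarrow> b k \<le> a l"
  obtains e :: "nat \<Rightarrow> nat" where "bij_betw e {1..card S} S"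
    "interlaced (card S) (a \<circ> e) (b \<circ> e)"
proof -
  define e where "e k = sorted_list_of_set S ! (k - 1)" for k
  have "bij_betw (\<lambda>k. k - 1) {1..card S} {..<card S}"
    by (rule bij_betwI[where g = Suc]) auto
  moreover have "bij_betw (\<lambda>k. sorted_list_of_set S ! k) {..<card S} S"
    using assms(1) by (intro bij_betw_nth) (auto simp: set_sorted_list_of_set)
  ultimately have e: "bij_betw e {1..card S} S"
    unfolding e_def using bij_betw_trans[unfolded comp_def] by blast
  then have eS: "e k \<in> S" if "k \<in> {1..card S}" for k
    using that by (auto simp: bij_betw_def)
  have "e k < e (Suc k)" if "k \<in> {1..<card S}" for k
  proof -
    have "sorted_wrt (<) (sorted_list_of_set S)" by simp
    then show ?thesis using that assms(1) unfolding e_def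
      by (subst sorted_wrt_nth_less[of "(<)"]) auto
  qed
  then have "interlaced (card S) (a \<circ> e) (b \<circ> e)"
    using assms(2,3) eS unfolding interlaced_def by auto
  with e that show ?thesis by blast
qed

lemma rises_cardI:
  fixes S :: "nat set"
  assumes "finite S"
    and "\<And>k. k \<in> S \<Longrightarrow> 1 \<le> a k \<and> a k < b k"
    and "\<And>k l. k \<in> S \<Longrightarrow> l \<in> S \<Longrightarrow> k < l \<Longrightarrow> b k \<le> a l"
    and "\<And>k. k \<in> S \<Longrightarrow> C * g (a k) \<le> g (b k)"
  shows "rises C g (card S)"
proof -
  obtain e :: "nat \<Rightarrow> nat" where e: "bij_betw e {1..card S} S"
    "interlaced (card S) (a \<circ> e) (b \<circ> e)"
    using interlaced_subchain[of S a b] assms(1-3) by blast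
  have "e k \<in> S" if "k \<in> {1..card S}" for k
    using that e(1) by (auto simp: bij_betw_def)
  then show ?thesis unfolding rises_def using e(2) assms(4)
    by (intro exI[of _ "a \<circ> e"] exI[of _ "b \<circ> e"]) auto
qed

lemma rises_mono:
  assumes "rises C g n" "C' \<le> C" "\<And>t. t \<ge> 1 \<Longrightarrow> g t > 0"
  shows "rises C' g n"
proof -
  obtain a b where ab: "interlaced n a b" "\<And>k. k \<in> {1..n} \<Longrightarrow> C * g (a k) \<le> g (b k)"
    using assms(1) unfolding rises_def by blast
  have "C' * g (a k) \<le> g (b k)" if "k \<in> {1..n}" for k
  proof -
    have "g (a k) > 0" using ab(1) that assms(3) by (auto simp: interlaced_def)
    then have "C' * g (a k) \<le> C * g (a k)" using assms(2) by (intro mult_right_mono) auto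
    then show ?thesis using ab(2)[OF that] by simp
  qed
  then show ?thesis unfolding rises_def using ab(1) by blast
qed

text \<open>Telescoping the logarithm: \<open>n\<close> falls by \<open>K\<^sup>2\<close> must be compensated by the \<open>n - 1\<close> gaps, and the
  gaps on which \<open>g\<close> rises by less than \<open>K\<close> make up for only half of it.\<close>
lemma falls_le_rises:
  fixes g :: "real \<Rightarrow> real"
  assumes "K > 1" "L > 0" "\<And>t. t \<ge> 1 \<Longrightarrow> L \<le> g t \<and> g t \<le> U"
    and N: "\<And>n. rises K g n \<Longrightarrow> real n \<le> N"
    and "rises (K^2) (\<lambda>t. inverse (g t)) n"
  shows "real n * ln K \<le> (N + 1) * ln (U / L)"
proof -
  obtain a b where ab: "interlaced n a b"
    and fall: "\<And>k. k \<in> {1..n} \<Longrightarrow> K^2 * inverse (g (a k)) \<le> inverse (g (b k))"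
    using assms(5) unfolding rises_def by blast
  define R where "R = ln (U / L)"
  have pos: "g t > 0" if "t \<ge> 1" for t using assms(2) assms(3)[OF that] by linarith
  have LU: "L \<le> U" using assms(3)[of 1] by linarith
  then have R0: "R \<ge> 0" unfolding R_def using assms(2) by simp
  have diff: "ln (g s) - ln (g t) \<le> R" if "s \<ge> 1" "t \<ge> 1" for s t
  proof -
    have "ln (g s) - ln (g t) \<le> ln U - ln L"
      using assms(2) assms(3)[OF that(1)] assms(3)[OF that(2)] pos[OF that(1)] pos[OF that(2)]
      by (intro diff_mono) (auto simp: ln_mono)
    also have "\<dots> = R" unfolding R_def using assms(2) LU by (simp add: ln_div)
    finally show ?thesis .
  qed
  have a1: "a k \<ge> 1" "b k \<ge> 1" if "k \<in> {1..n}" for k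
    using ab that by (force simp: interlaced_def)+
  have fall': "2 * ln K \<le> ln (g (a k)) - ln (g (b k))" if "k \<in> {1..n}" for k
  proof -
    have p: "g (a k) > 0" "g (b k) > 0" using a1[OF that] pos by auto
    have "K^2 * g (b k) \<le> g (a k)" using fall[OF that] p by (simp add: field_simps)
    then have "ln (K^2 * g (b k)) \<le> ln (g (a k))" using p assms(1) by (intro ln_mono) auto
    then show ?thesis using p assms(1) by (simp add: ln_mult ln_realpow)
  qed
  \<comment> \<open>The gaps on which \<open>g\<close> rises by \<open>K\<close> form a chain of
    their own, so \<open>N\<close> bounds their number. Such a gap recovers at most the full
    logarithmic range \<open>R\<close>, any other gap at most \<open>ln K\<close>.\<close>
  define S where "S = {k \<in> {1..<n}. K * g (b k) \<le> g (a (Suc k))}"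
  have finS: "finite S" unfolding S_def by simp
  have "rises K g (card S)"
  proof (rule rises_cardI[where a = b and b = "\<lambda>k. a (Suc k)"])
    fix k assume k: "k \<in> S"
    then have b1: "1 \<le> b k" "b k \<le> a (Suc k)" using ab a1 by (auto simp: S_def interlaced_def)
    \<comment> \<open>Consecutive intervals may touch; such an empty gap cannot carry a rise,
      because \<open>K > 1\<close> and \<open>g\<close> is positive.\<close>
    have "b k \<noteq> a (Suc k)"
    proof
      assume "b k = a (Suc k)"
      then have "K * g (b k) \<le> 1 * g (b k)" using k by (simp add: S_def)
      then show False using pos[OF b1(1)] assms(1) by simp
    qed
    then show "1 \<le> b k \<and> b k < a (Suc k)" using b1 by simp
  next
    fix k l assume kl: "k \<in> S" "l \<in> S" "k < l"
    have "a (Suc k) \<le> b (Suc k)" "Suc k < l \<Longrightarrow> b (Suc k) \<le> a l" "a l \<le> b l"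
      using ab kl interlaced_le[OF ab, of "Suc k" l] by (auto simp: S_def interlaced_def intro: less_imp_le)
    then show "a (Suc k) \<le> b l" using kl by (cases "Suc k = l") auto
  qed (use finS in \<open>auto simp: S_def\<close>)
  then have cS: "real (card S) \<le> N" by (rule N)
  have gap: "ln (g (a (Suc k))) - ln (g (b k)) \<le> ln K + (if k \<in> S then R else 0)"
    if "k \<in> {1..<n}" for k
  proof (cases "k \<in> S")
    case True
    then show ?thesis using diff[of "a (Suc k)" "b k"] a1[of k] a1[of "Suc k"] that assms(1)
      by (auto intro: add_increasing)
  next
    case False
    have p: "g (a (Suc k)) > 0" "g (b k) > 0" using that a1[of k] a1[of "Suc k"] pos by auto
    have "ln (g (a (Suc k))) \<le> ln (K * g (b k))"
      using False that p assms(1) by (intro ln_mono) (auto simp: S_def)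
    then show ?thesis using False p assms(1) by (simp add: ln_mult)
  qed
  show ?thesis
  proof (cases "n = 0")
    case True
    have "N \<ge> 0" using cS by linarith
    then show ?thesis using True R0 R_def by simp
  next
    case False
    have telescope: "(\<Sum>k=1..m. ln (g (a k)) - ln (g (b k))) =
        (ln (g (a 1)) - ln (g (b m))) + (\<Sum>k=1..<m. ln (g (a (Suc k))) - ln (g (b k)))"
      if "m > 0" for m
      using that by (induction m rule: nat_induct_non_zero) auto
    \<comment> \<open>Falls cost \<open>2 * ln K\<close> each and the gaps of small rise return at
      most \<open>ln K\<close> each. The remaining \<open>ln K\<close> per fall has to be covered by
      the range \<open>R\<close>, used at most \<open>N + 1\<close> times.\<close>
    have "real n * (2 * ln K) = (\<Sum>k=1..n. 2 * ln K)" by simp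
    also have "\<dots> \<le> (\<Sum>k=1..n. ln (g (a k)) - ln (g (b k)))"
      by (intro sum_mono fall')
    also have "\<dots> = (ln (g (a 1)) - ln (g (b n))) + (\<Sum>k=1..<n. ln (g (a (Suc k))) - ln (g (b k)))"
      using telescope False by simp
    also have "\<dots> \<le> R + (\<Sum>k=1..<n. ln K + (if k \<in> S then R else 0))"
      using False a1[of 1] a1[of n] by (intro add_mono diff sum_mono gap) auto
    also have "(\<Sum>k=1..<n. ln K + (if k \<in> S then R else 0)) = real (n - 1) * ln K + real (card S) * R"
    proof -
      have "{1..<n} \<inter> S = S" by (auto simp: S_def)
      then show ?thesis by (simp add: sum.distrib sum.If_cases)
    qed
    also have "R + \<dots> \<le> R + (real n * ln K + N * R)"
      using cS R0 assms(1) by (intro add_mono mult_right_mono) auto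
    finally show ?thesis unfolding R_def by (simp add: algebra_simps)
  qed
qed

section \<open>Elasticity as a bound on chain lengths\<close>

lemma Sup_enat_ge: "P n \<Longrightarrow> enat n \<le> Sup {enat n |n. P n}"
  by (rule Sup_upper) auto

text \<open>Trades the suprema for bounds on individual chains. Each count is at most the sum of the
  two; conversely, bounding both counts bounds their sum at the price of doubling
  \<open>C1\<close>.\<close>

lemma elastic_at_infinity_iff:
  assumes pos: "\<And>t x. t \<ge> 1 \<Longrightarrow> 0 < x \<Longrightarrow> x \<le> 1 \<Longrightarrow> dilate F t x > 0"
  shows "elastic_at_infinity F \<longleftrightarrow>
    (\<exists>C0 C1 r. C0 > 1 \<and> C1 > 1 \<and> r > 0 \<and> (\<forall>x n. 0 < x \<and> x \<le> 1 \<longrightarrow>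
       (rises C0 (\<lambda>t. dilate F t x) n \<longrightarrow> real n \<le> C1 * x powr (- r)) \<and>
       (rises C0 (\<lambda>t. inverse (dilate F t x)) n \<longrightarrow> real n \<le> C1 * x powr (- r))))"
proof -
  have minus: "(\<exists>a b. interlaced n a b \<and> (\<forall>k\<in>{1..n}. dilate F (a k) x \<ge> C * dilate F (b k) x))
      \<longleftrightarrow> rises C (\<lambda>t. inverse (dilate F t x)) n" if "0 < x" "x \<le> 1" for x C n
  proof -
    have "dilate F (a k) x \<ge> C * dilate F (b k) x \<longleftrightarrow>
        C * inverse (dilate F (a k) x) \<le> inverse (dilate F (b k) x)"
      if "interlaced n a b" "k \<in> {1..n}" for a b k
    proof -
      have "a k \<ge> 1" "a k < b k" using that by (auto simp: interlaced_def)
      then have "dilate F (a k) x > 0" "dilate F (b k) x > 0"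
        using \<open>0 < x\<close> \<open>x \<le> 1\<close> by (auto intro!: pos)
      then show ?thesis by (simp add: field_simps)
    qed
    then show ?thesis unfolding rises_def by blast
  qed
  have Phi: "Phi_plus_inf F x C = Sup {enat n |n. rises C (\<lambda>t. dilate F t x) n}"
     "Phi_minus_inf F x C = Sup {enat n |n. rises C (\<lambda>t. inverse (dilate F t x)) n}"
    if "0 < x" "x \<le> 1" for x C
    unfolding Phi_plus_inf_def Phi_minus_inf_def minus[OF that] by (simp_all add: rises_def)
  show ?thesis
  proof
    assume "elastic_at_infinity F"
    then obtain C0 C1 r where C: "C0 > 1" "C1 > 1" "r > 0"
      and le: "\<And>x. 0 < x \<Longrightarrow> x \<le> 1 \<Longrightarrow>
         ereal_of_enat (Phi_plus_inf F x C0 + Phi_minus_inf F x C0) \<le> ereal (C1 * x powr (- r))"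
      unfolding elastic_at_infinity_def by blast
    have "real n \<le> C1 * x powr (- r)" if x: "0 < x" "x \<le> 1"
      and n: "rises C0 (\<lambda>t. dilate F t x) n \<or> rises C0 (\<lambda>t. inverse (dilate F t x)) n" for x n
    proof -
      have "enat n \<le> Phi_plus_inf F x C0 + Phi_minus_inf F x C0"
        using n unfolding Phi[OF x]
        by (auto intro: Sup_enat_ge add_increasing add_increasing2)
      then have "ereal_of_enat (enat n) \<le> ereal_of_enat (Phi_plus_inf F x C0 + Phi_minus_inf F x C0)"
        by (simp only: ereal_of_enat_le_iff)
      also note le[OF x]
      finally show ?thesis by simp
    qed
    then show "\<exists>C0 C1 r. C0 > 1 \<and> C1 > 1 \<and> r > 0 \<and> (\<forall>x n. 0 < x \<and> x \<le> 1 \<longrightarrow>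
       (rises C0 (\<lambda>t. dilate F t x) n \<longrightarrow> real n \<le> C1 * x powr (- r)) \<and>
       (rises C0 (\<lambda>t. inverse (dilate F t x)) n \<longrightarrow> real n \<le> C1 * x powr (- r)))"
      using C by blast
  next
    assume "\<exists>C0 C1 r. C0 > 1 \<and> C1 > 1 \<and> r > 0 \<and> (\<forall>x n. 0 < x \<and> x \<le> 1 \<longrightarrow>
       (rises C0 (\<lambda>t. dilate F t x) n \<longrightarrow> real n \<le> C1 * x powr (- r)) \<and>
       (rises C0 (\<lambda>t. inverse (dilate F t x)) n \<longrightarrow> real n \<le> C1 * x powr (- r)))"
    then obtain C0 C1 r where C: "C0 > 1" "C1 > 1" "r > 0"
      and le: "\<And>x n. 0 < x \<Longrightarrow> x \<le> 1 \<Longrightarrow> rises C0 (\<lambda>t. dilate F t x) n \<Longrightarrow> real n \<le> C1 * x powr (- r)"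
        "\<And>x n. 0 < x \<Longrightarrow> x \<le> 1 \<Longrightarrow> rises C0 (\<lambda>t. inverse (dilate F t x)) n \<Longrightarrow> real n \<le> C1 * x powr (- r)"
      by blast
    have "ereal_of_enat (Phi_plus_inf F x C0 + Phi_minus_inf F x C0) \<le> ereal (2 * C1 * x powr (- r))"
      if x: "0 < x" "x \<le> 1" for x
    proof -
      define B where "B = nat \<lfloor>C1 * x powr (- r)\<rfloor>"
      have "Phi_plus_inf F x C0 \<le> enat B" "Phi_minus_inf F x C0 \<le> enat B"
        unfolding Phi[OF x] B_def using le[OF x] by (auto intro!: Sup_least le_nat_floor)
      then have "Phi_plus_inf F x C0 + Phi_minus_inf F x C0 \<le> enat (2 * B)"
        by (metis add_mono mult_2 plus_enat_simps(1))
      then have "ereal_of_enat (Phi_plus_inf F x C0 + Phi_minus_inf F x C0) \<le> ereal_of_enat (enat (2 * B))"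
        by (simp only: ereal_of_enat_le_iff)
      also have "\<dots> \<le> ereal (2 * C1 * x powr (- r))"
      proof -
        have "real B \<le> C1 * x powr (- r)" unfolding B_def using C by (intro of_nat_floor) auto
        then show ?thesis by simp
      qed
      finally show ?thesis .
    qed
    then show "elastic_at_infinity F"
      unfolding elastic_at_infinity_def using C
      by (intro exI[of _ C0] exI[of _ "2 * C1"] exI[of _ r]) auto
  qed
qed

section \<open>From jump counts to a bounded potential\<close>

text \<open>Since \<open>h t (x ^ m)\<close> is a product of \<open>m\<close> values of \<open>h\<close> at \<open>x\<close>, a rise by \<open>C ^ m\<close> at \<open>x ^ m\<close>
  forces a rise by \<open>C\<close> at \<open>x\<close>, at one of \<open>m\<close> scales. As \<open>x ^ m\<close> is much smaller than \<open>x\<close>, this lowers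
  the exponent of a polynomial bound by the factor \<open>m\<close>. The scales leave \<open>[1,\<infinity>)\<close> when \<open>a k < 2 ^ (m * j)\<close>,
  but by doubling there are at most \<open>m * j\<close> such intervals.\<close>
lemma rises_power_le:
  fixes h :: "real \<Rightarrow> real \<Rightarrow> real"
  assumes "C > 0" "C ^ m > D" "m > 0"
    and x: "x = 1 / 2 ^ j"
    and pos: "\<And>t x. t > 0 \<Longrightarrow> 0 < x \<Longrightarrow> x \<le> 1 \<Longrightarrow> h t x > 0"
    and mult: "\<And>t x. t > 0 \<Longrightarrow> 0 < x \<Longrightarrow> x \<le> 1 \<Longrightarrow> h t (x ^ m) = (\<Prod>i<m. h (t * x ^ i) x)"
    and double: "\<And>s t x. 0 < s \<Longrightarrow> s \<le> t \<Longrightarrow> t \<le> 2 * s \<Longrightarrow> 0 < x \<Longrightarrow> x \<le> 1 \<Longrightarrow> h t x \<le> D * h s x"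
    and N: "\<And>n. rises C (\<lambda>t. h t x) n \<Longrightarrow> real n \<le> N"
    and n: "rises (C ^ m) (\<lambda>t. h t (x ^ m)) n"
  shows "real n \<le> real m * real j + real m * N"
proof -
  obtain a b where ab: "interlaced n a b"
    and rise: "\<And>k. k \<in> {1..n} \<Longrightarrow> C ^ m * h (a k) (x ^ m) \<le> h (b k) (x ^ m)"
    using n unfolding rises_def by blast
  have x01: "0 < x" "x \<le> 1" using x by (auto simp: divide_le_eq)
  then have xm: "0 < x ^ i" "x ^ i \<le> 1" for i by (auto simp: power_le_one)
  have ab1: "1 \<le> a k" "a k < b k" if "k \<in> {1..n}" for k
    using ab that by (auto simp: interlaced_def)
  \<comment> \<open>Doubling allows a factor of at most \<open>D < C ^ m\<close> between
    \<open>s\<close> and \<open>2 * s\<close>, so a rise by \<open>C ^ m\<close> needs a longer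
    interval. This makes the \<open>a k\<close> grow geometrically.\<close>
  have two: "2 * a k < b k" if k: "k \<in> {1..n}" for k
  proof (rule ccontr)
    assume "\<not> 2 * a k < b k"
    then have "h (b k) (x ^ m) \<le> D * h (a k) (x ^ m)"
      using ab1[OF k] xm by (intro double) auto
    moreover have "D * h (a k) (x ^ m) < C ^ m * h (a k) (x ^ m)"
      using ab1[OF k] xm assms(2) by (intro mult_strict_right_mono pos) auto
    ultimately show False using rise[OF k] by linarith
  qed
  have growth: "2 ^ k \<le> a (Suc k)" if "k < n" for k
    using that
  proof (induction k)
    case 0
    then show ?case using ab1[of 1] by simp
  next
    case (Suc k)
    then have "2 ^ Suc k \<le> 2 * a (Suc k)" by simp
    also have "\<dots> < b (Suc k)" using Suc.prems by (intro two) auto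
    also have "\<dots> \<le> a (Suc (Suc k))" using Suc.prems ab by (auto simp: interlaced_def)
    finally show ?case by simp
  qed
  \<comment> \<open>Sorts the intervals by the factor of the product that rises; one interval may
    occur for several \<open>i\<close>, as only an upper bound is wanted. The condition with
    \<open>x ^ m\<close> keeps every scaled left endpoint at least 1.\<close>
  define S where "S i = {k \<in> {1..n}. 1 \<le> a k * x ^ m \<and> C * h (a k * x ^ i) x \<le> h (b k * x ^ i) x}" for i
  have finS: "finite (S i)" for i unfolding S_def by simp
  have cover: "{1..n} \<subseteq> {1..m * j} \<union> (\<Union>i<m. S i)"
  proof
    fix k assume k: "k \<in> {1..n}"
    show "k \<in> {1..m * j} \<union> (\<Union>i<m. S i)"
    proof (rule ccontr)
      assume "\<not> ?thesis"
      then have km: "m * j < k" and notS: "\<And>i. i < m \<Longrightarrow> k \<notin> S i" using k by auto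
      have "(2::real) ^ (m * j) \<le> 2 ^ (k - 1)" using km by (intro power_increasing) auto
      also have "\<dots> \<le> a k" using growth[of "k - 1"] k by auto
      finally have ak: "1 \<le> a k * x ^ m"
        unfolding x by (simp add: power_divide power_mult mult.commute field_simps flip: power_mult)
      have lt: "h (b k * x ^ i) x < C * h (a k * x ^ i) x" if "i < m" for i
        using notS[OF that] ak k by (auto simp: S_def)
      have nn: "0 < h (b k * x ^ i) x" for i
        using ab1[OF k] xm x01 by (intro pos) auto
      have "h (b k) (x ^ m) = (\<Prod>i<m. h (b k * x ^ i) x)"
        using ab1[OF k] x01 by (intro mult) auto
      also have "\<dots> < (\<Prod>i<m. C * h (a k * x ^ i) x)"
        using lt less_trans[OF nn lt] nn assms(3) by (intro prod_mono_strict) (auto intro: less_imp_le)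
      also have "\<dots> = C ^ m * (\<Prod>i<m. h (a k * x ^ i) x)"
        by (simp add: prod.distrib)
      also have "\<dots> = C ^ m * h (a k) (x ^ m)"
        using ab1[OF k] x01 by (subst mult) auto
      finally show False using rise[OF k] by simp
    qed
  qed
  have cS: "real (card (S i)) \<le> N" if "i < m" for i
  proof (rule N, rule rises_cardI[where a = "\<lambda>k. a k * x ^ i" and b = "\<lambda>k. b k * x ^ i"])
    fix k assume k: "k \<in> S i"
    then have "1 \<le> a k * x ^ m" "k \<in> {1..n}" by (auto simp: S_def)
    moreover have "a k * x ^ m \<le> a k * x ^ i"
      using ab1[OF \<open>k \<in> {1..n}\<close>] x01 that by (intro mult_left_mono power_decreasing) auto
    ultimately show "1 \<le> a k * x ^ i \<and> a k * x ^ i < b k * x ^ i"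
      using ab1[of k] xm order_trans by (metis mult_strict_right_mono)
  next
    fix k l assume "k \<in> S i" "l \<in> S i" "k < l"
    then have "b k \<le> a l" by (intro interlaced_le[OF ab]) (auto simp: S_def)
    then show "b k * x ^ i \<le> a l * x ^ i" using xm[of i] by (intro mult_right_mono) auto
  qed (use finS in \<open>auto simp: S_def\<close>)
  have "n = card {1..n}" by simp
  also have "\<dots> \<le> card ({1..m * j} \<union> (\<Union>i<m. S i))"
    using cover finS by (intro card_mono) auto
  also have "\<dots> \<le> card {1..m * j} + card (\<Union>i<m. S i)" by (rule card_Un_le)
  also have "\<dots> \<le> m * j + (\<Sum>i<m. card (S i))"
    using card_UN_le[of "{..<m}" S] by simp
  finally have "real n \<le> real m * real j + (\<Sum>i<m. real (card (S i)))"
    by (metis of_nat_add of_nat_le_iff of_nat_mult of_nat_sum)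
  also have "\<dots> \<le> real m * real j + (\<Sum>i<m. N)"
    using cS by (intro add_left_mono sum_mono) auto
  finally show ?thesis by simp
qed

text \<open>The potential \<open>w t\<close> is a weighted sum of the longest chains that fit into \<open>[1,t]\<close>.\<close>
lemma rises_potential:
  fixes g :: "nat \<Rightarrow> real \<Rightarrow> real" and y B :: "nat \<Rightarrow> real"
  assumes y: "\<And>j. y j > 0" and K: "K > 1"
    and pos: "\<And>j t. t \<ge> 1 \<Longrightarrow> g j t > 0"
    and count: "\<And>j n. rises K (g j) n \<Longrightarrow> y j * real n \<le> B j"
    and B: "summable B"
  obtains w :: "real \<Rightarrow> real" where "bounded (w ` {1..})" "mono_on {1..} w"
    "\<And>j s t. 1 \<le> s \<Longrightarrow> s \<le> t \<Longrightarrow> K * g j s \<le> g j t \<Longrightarrow> y j \<le> w t - w s"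
proof -
  define A where "A j t = {n. \<exists>a b. interlaced n a b \<and>
    (\<forall>k\<in>{1..n}. K * g j (a k) \<le> g j (b k)) \<and> (\<forall>k\<in>{1..n}. b k \<le> t)}" for j t
  define N where "N j t = Max (A j t)" for j t
  have A_rises: "rises K (g j) n" if "n \<in> A j t" for j n t
    using that unfolding A_def rises_def by blast
  have finA: "finite (A j t)" for j t
  proof (rule finite_subset)
    show "A j t \<subseteq> {..nat \<lfloor>B j / y j\<rfloor>}"
    proof
      fix n assume "n \<in> A j t"
      then have "y j * real n \<le> B j" by (intro count A_rises)
      then have "real n \<le> B j / y j" using y[of j] by (simp add: field_simps)
      then show "n \<in> {..nat \<lfloor>B j / y j\<rfloor>}" by (simp add: le_nat_floor)
    qed
  qed simp
  have A0: "0 \<in> A j t" for j t by (simp add: A_def interlaced_def)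
  have N_in: "N j t \<in> A j t" for j t
    unfolding N_def using finA A0 by (intro Max_in) blast+
  have N_bound: "y j * real (N j t) \<le> B j" for j t
    using count[OF A_rises[OF N_in]] .
  have N_mono: "N j s \<le> N j t" if "s \<le> t" for j s t
  proof -
    have "A j s \<subseteq> A j t"
    proof
      fix n assume "n \<in> A j s"
      then obtain a b where "interlaced n a b" "\<forall>k\<in>{1..n}. K * g j (a k) \<le> g j (b k)"
        "\<forall>k\<in>{1..n}. b k \<le> s" unfolding A_def by blast
      with that show "n \<in> A j t" unfolding A_def by fastforce
    qed
    then show ?thesis unfolding N_def using finA A0 by (intro Max_mono) blast+
  qed
  have N_Suc: "Suc (N j s) \<le> N j t" if st: "1 \<le> s" "s \<le> t" "K * g j s \<le> g j t" for j s t
  proof -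
    have "s \<noteq> t"
    proof
      assume "s = t"
      then have "K * g j s \<le> 1 * g j s" using st by simp
      then show False using pos[OF st(1), of j] K by simp
    qed
    then have "s < t" using st by simp
    define n where "n = N j s"
    obtain a b where ab: "interlaced n a b" "\<forall>k\<in>{1..n}. K * g j (a k) \<le> g j (b k)"
        "\<forall>k\<in>{1..n}. b k \<le> s"
      using N_in[of j s] unfolding A_def n_def by blast
    \<comment> \<open>A longest chain up to \<open>s\<close> is extended by the interval from
      \<open>s\<close> to \<open>t\<close>, so every jump raises the count by at least one.\<close>
    have "interlaced (Suc n) (a(Suc n := s)) (b(Suc n := t))"
      using ab st \<open>s < t\<close> by (auto simp: interlaced_def le_Suc_eq less_Suc_eq)
    moreover have "\<forall>k\<in>{1..Suc n}. (b(Suc n := t)) k \<le> t" "\<forall>k\<in>{1..Suc n}.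
        K * g j ((a(Suc n := s)) k) \<le> g j ((b(Suc n := t)) k)"
      using ab st by (force simp: le_Suc_eq)+
    ultimately have "Suc n \<in> A j t" unfolding A_def by blast
    then show ?thesis unfolding N_def[of j t] n_def[symmetric] using finA by (intro Max_ge) auto
  qed
  define w where "w t = (\<Sum>j. y j * real (N j t))" for t
  have yN0: "0 \<le> y j * real (N j t)" for j t using y[of j] by simp
  have summ: "summable (\<lambda>j. y j * real (N j t))" for t
    using B by (rule summable_comparison_test') (use N_bound yN0 in auto)
  have yN_mono: "y j * real (N j s) \<le> y j * real (N j t)" if "s \<le> t" for j s t
    using N_mono[OF that] y[of j] by (intro mult_left_mono) auto
  have w_mono: "w s \<le> w t" if "s \<le> t" for s t
    unfolding w_def by (intro suminf_le summ yN_mono that)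
  have w_bound: "0 \<le> w t" "w t \<le> suminf B" for t
    unfolding w_def by (intro suminf_nonneg summ yN0, intro suminf_le summ B N_bound)
  show ?thesis
  proof
    show "bounded (w ` {1..})"
      unfolding bounded_iff using w_bound by (auto intro!: exI[of _ "suminf B"])
    show "mono_on {1..} w" by (auto intro!: mono_onI w_mono)
  next
    fix j and s t :: real assume st: "1 \<le> s" "s \<le> t" "K * g j s \<le> g j t"
    define f where "f i = y i * real (N i t) - y i * real (N i s)" for i
    have f: "summable f" "w t - w s = suminf f"
      unfolding f_def w_def using summ by (auto intro: summable_diff simp: suminf_diff)
    have f0: "0 \<le> f i" for i unfolding f_def using yN_mono[OF st(2)] by simp
    \<comment> \<open>All terms of the difference are nonnegative, so the increment of
      \<open>w\<close> dominates its \<open>j\<close>-th term, and the jump makes that term at least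
      \<open>y j\<close>.\<close>
    have "y j \<le> f j"
    proof -
      have "y j * 1 \<le> y j * (real (N j t) - real (N j s))"
        using N_Suc[OF st] y[of j] by (intro mult_left_mono) auto
      then show ?thesis unfolding f_def by (simp add: algebra_simps)
    qed
    also have "f j = sum f {j}" by simp
    also have "\<dots> \<le> suminf f" using f f0 by (intro sum_le_suminf) auto
    finally show "y j \<le> w t - w s" using f by simp
  qed
qed

text \<open>Stated for an abstract \<open>h\<close> so that it applies to \<open>dilate F\<close>
  and to its reciprocal. For large \<open>m\<close> the jump count at \<open>2 ^ (- m * j)\<close>,
  weighted by that same number, is \<open>O(2 ^ (- j))\<close>, which is the summability that
  \<open>rises_potential\<close> asks for.\<close>

lemma multiplicative_potential:
  fixes h :: "real \<Rightarrow> real \<Rightarrow> real"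
  assumes "C0 > 1" "C1 > 0"
    and pos: "\<And>t x. t > 0 \<Longrightarrow> 0 < x \<Longrightarrow> x \<le> 1 \<Longrightarrow> h t x > 0"
    and mult: "\<And>t x m. t > 0 \<Longrightarrow> 0 < x \<Longrightarrow> x \<le> 1 \<Longrightarrow> h t (x ^ m) = (\<Prod>i<m. h (t * x ^ i) x)"
    and double: "\<And>s t x. 0 < s \<Longrightarrow> s \<le> t \<Longrightarrow> t \<le> 2 * s \<Longrightarrow> 0 < x \<Longrightarrow> x \<le> 1 \<Longrightarrow> h t x \<le> D * h s x"
    and count: "\<And>n x. 0 < x \<Longrightarrow> x \<le> 1 \<Longrightarrow> rises C0 (\<lambda>t. h t x) n \<Longrightarrow> real n \<le> C1 * x powr (- r)"
  obtains m K w where "m > 0" "K > (1::real)" "bounded (w ` {1..})" "mono_on {1..} w"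
    "\<And>j s t. 1 \<le> s \<Longrightarrow> s \<le> t \<Longrightarrow> K * h s ((1 / 2 ^ j) ^ m) \<le> h t ((1 / 2 ^ j) ^ m)
       \<Longrightarrow> (1 / 2 ^ j) ^ m \<le> (w t - w s :: real)"
proof -
  obtain m0 where m0: "D < C0 ^ m0" using real_arch_pow[OF assms(1)] by blast
  \<comment> \<open>\<open>m0\<close> makes \<open>C0 ^ m\<close> exceed the doubling constant,
    \<open>nat \<lceil>r\<rceil>\<close> makes \<open>r \<le> m - 1\<close>, and the second
    \<open>Suc\<close> ensures \<open>1 \<le> m - 1\<close>.\<close>
  define m where "m = Suc (Suc (max m0 (nat \<lceil>r\<rceil>)))"
  have m: "m > 0" "r \<le> real (m - 1)" "1 \<le> m - 1" unfolding m_def by linarith+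
  have "C0 ^ m0 \<le> C0 ^ m" unfolding m_def using assms(1) by (intro power_increasing) auto
  then have Dm: "D < C0 ^ m" using m0 by simp
  have Km: "C0 ^ m > 1" using assms(1) m by (intro one_less_power) auto
  have bound: "(1 / 2 ^ j) ^ m * real n \<le> real m * (1 + C1) * (1 / 2) ^ j"
    if n: "rises (C0 ^ m) (\<lambda>t. h t ((1 / 2 ^ j) ^ m)) n" for j n
  proof -
    \<comment> \<open>In terms of the reciprocal \<open>z\<close> of the base point, the linear term
      \<open>j\<close> and the term \<open>z powr r\<close> are both at most
      \<open>z ^ (m - 1)\<close>. Dividing by \<open>z ^ m\<close> then leaves a geometric
      term.\<close>
    define z where "z = (2::real) ^ j"
    have z: "z \<ge> 1" unfolding z_def by simp
    have "real n \<le> real m * real j + real m * (C1 * (1 / 2 ^ j) powr (- r))"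
    proof (rule rises_power_le[OF _ Dm m(1) refl pos mult double _ n])
      show "real n \<le> C1 * (1 / 2 ^ j) powr - r" if "rises C0 (\<lambda>t. h t (1 / 2 ^ j)) n" for n
        using that by (intro count) (auto simp: divide_le_eq)
    qed (use assms(1) in auto)
    also have "(1 / 2 ^ j) powr (- r) = z powr r"
      unfolding z_def by (simp add: powr_minus powr_divide)
    also have "z powr r \<le> z powr real (m - 1)" using z m by (intro powr_mono) auto
    also have "z powr real (m - 1) = z ^ (m - 1)" using z by (intro powr_realpow) auto
    also have "real j \<le> z ^ (m - 1)"
    proof -
      have "real j \<le> z" unfolding z_def by (metis less_exp of_nat_less_numeral_power_cancel_iff less_imp_le)
      also have "z ^ 1 \<le> z ^ (m - 1)" using z m by (intro power_increasing) auto
      finally show ?thesis by simp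
    qed
    finally have "real n \<le> real m * z ^ (m - 1) + real m * (C1 * z ^ (m - 1))"
      using assms(2) by (simp add: mult_left_mono)
    then have "z * real n \<le> z * (real m * z ^ (m - 1) + real m * (C1 * z ^ (m - 1)))"
      using z by (intro mult_left_mono) auto
    also have "\<dots> = real m * (1 + C1) * z ^ m"
      using m by (subst power_eq_if[of z m]) (auto simp: algebra_simps)
    finally have "real n / z ^ m \<le> real m * (1 + C1) / z"
      using z by (simp add: field_simps)
    then show ?thesis unfolding z_def by (simp add: power_divide)
  qed
  have "summable (\<lambda>j. real m * (1 + C1) * (1 / 2) ^ j)"
    by (intro summable_mult summable_geometric) auto
  moreover have "h t ((1 / 2 ^ j) ^ m) > 0" if "t \<ge> 1" for j t
    using that by (intro pos power_le_one) auto
  moreover have "0 < (1 / 2 ^ j :: real) ^ m" for j by simp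
  ultimately show ?thesis
    using rises_potential[of "\<lambda>j. (1 / 2 ^ j) ^ m" "C0 ^ m" "\<lambda>j t. h t ((1 / 2 ^ j) ^ m)"
        "\<lambda>j. real m * (1 + C1) * (1 / 2) ^ j" thesis] that[OF m(1) Km] bound Km
    by blast
qed

text \<open>The increments telescope: as \<open>w\<close> is monotone, its increments over the gaps
  are nonnegative, so the sum is at most the increment from \<open>a 1\<close> to
  \<open>b n\<close>.\<close>

lemma interlaced_sum_le:
  fixes w :: "real \<Rightarrow> real"
  assumes "interlaced n a b" "mono_on {1..} w" "\<And>t. t \<ge> 1 \<Longrightarrow> \<bar>w t\<bar> \<le> M"
    and "\<And>k. k \<in> {1..n} \<Longrightarrow> f k \<le> w (b k) - w (a k)"
  shows "(\<Sum>k=1..n. f k) \<le> 2 * M"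
proof -
  have M0: "M \<ge> 0" using assms(3)[of 1] by simp
  have ab1: "1 \<le> a k" "1 \<le> b k" if "k \<in> {1..n}" for k
    using assms(1) that by (force simp: interlaced_def)+
  have "n > 0 \<longrightarrow> (\<Sum>k=1..n. f k) \<le> w (b n) - w (a 1)"
    using assms(1,4) ab1
  proof (induction n)
    case (Suc n)
    have last: "f (Suc n) \<le> w (b (Suc n)) - w (a (Suc n))" using Suc.prems(2) by simp
    show ?case
    proof (cases "n = 0")
      case False
      have "b n \<le> a (Suc n)" using Suc.prems(1) False by (auto simp: interlaced_def)
      then have "w (b n) \<le> w (a (Suc n))"
        using Suc.prems(3)[of "Suc n"] Suc.prems(4)[of n] False by (intro mono_onD[OF assms(2)]) auto
      moreover have "(\<Sum>k=1..n. f k) \<le> w (b n) - w (a 1)"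
        using Suc False by (simp add: interlaced_def)
      ultimately show ?thesis using last by simp
    qed (use last in simp)
  qed simp
  then have *: "(\<Sum>k=1..n. f k) \<le> w (b n) - w (a 1)" if "n > 0"
    using that by simp
  show ?thesis
  proof (cases "n = 0")
    case True
    then show ?thesis using M0 by simp
  next
    case False
    then have "\<bar>w (b n)\<bar> \<le> M" "\<bar>w (a 1)\<bar> \<le> M" using ab1 by (auto intro!: assms(3))
    then show ?thesis using * False by linarith
  qed
qed

section \<open>Dilations of a doubling Orlicz function\<close>

locale doubling_orlicz =
  fixes F :: "real \<Rightarrow> real" and D :: real
  assumes orlicz: "orlicz_function F"
    and D_gt_1: "D > 1"
    and doubling: "\<And>x. x \<ge> 0 \<Longrightarrow> F (2 * x) \<le> D * F x"
begin

lemma F_0 [simp]: "F 0 = 0"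
  using orlicz by (simp add: orlicz_function_def)

lemma F_mono: "0 \<le> x \<Longrightarrow> x \<le> y \<Longrightarrow> F x \<le> F y"
  using orlicz unfolding orlicz_function_def by (intro strict_mono_on_leD[of "{0..}" F]) auto

lemma F_pos: "0 < x \<Longrightarrow> 0 < F x"
  using orlicz strict_mono_onD[of "{0..}" F 0 x] unfolding orlicz_function_def by auto

lemma F_doubling_power: "x \<ge> 0 \<Longrightarrow> F x \<le> D ^ n * F (x / 2 ^ n)"
proof (induction n)
  case (Suc n)
  have "F x \<le> D ^ n * F (x / 2 ^ n)" using Suc by simp
  also have "x / 2 ^ n = 2 * (x / 2 ^ Suc n)" by simp
  also have "D ^ n * F (2 * (x / 2 ^ Suc n)) \<le> D ^ n * (D * F (x / 2 ^ Suc n))"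
    using Suc.prems D_gt_1 by (intro mult_left_mono doubling) auto
  also have "\<dots> = D ^ Suc n * F (x / 2 ^ Suc n)" by (simp only: power_Suc mult.assoc mult.left_commute)
  finally show ?case .
qed simp

lemma dilate_pos: "0 < t \<Longrightarrow> 0 < x \<Longrightarrow> 0 < dilate F t x"
  by (simp add: dilate_def F_pos)

lemma dilate_0 [simp]: "dilate F t 0 = 0"
  by (simp add: dilate_def)

lemma dilate_mono: "0 < t \<Longrightarrow> 0 \<le> x \<Longrightarrow> x \<le> y \<Longrightarrow> dilate F t x \<le> dilate F t y"
  by (simp add: dilate_def F_pos F_mono divide_right_mono less_imp_le)

text \<open>Convexity on the segment from 0 to \<open>t\<close>, with \<open>F\<close> vanishing at
  0.\<close>

lemma dilate_le_self:
  assumes "0 < t" "0 \<le> x" "x \<le> 1"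
  shows "dilate F t x \<le> x"
proof -
  have "convex_on {0..} F" using orlicz by (simp add: orlicz_function_def)
  then have "F ((1 - x) *\<^sub>R 0 + x *\<^sub>R t) \<le> (1 - x) * F 0 + x * F t"
    using assms by (intro convex_onD) auto
  then show ?thesis using assms F_pos[of t] by (simp add: dilate_def field_simps)
qed

lemma dilate_doubling_power:
  assumes "0 < t" "0 \<le> x"
  shows "dilate F t x \<le> D ^ n * dilate F t (x / 2 ^ n)"
  using F_doubling_power[of "t * x" n] assms F_pos[of t]
  by (simp add: dilate_def divide_right_mono)

text \<open>Halving 1 about \<open>log 2 (1 / x)\<close> times leads to a point not above
  \<open>x\<close>. Each halving costs a factor \<open>D\<close>, and rounding the number of steps
  up costs at most one more.\<close>

lemma dilate_ge:
  assumes "0 < t" "0 < x" "x \<le> 1"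
  shows "x powr log 2 D / D \<le> dilate F t x"
proof -
  define j where "j = nat \<lceil>log 2 (1 / x)\<rceil>"
  have l0: "log 2 (1 / x) \<ge> 0" using assms by simp
  have j: "log 2 (1 / x) \<le> real j" "real j \<le> log 2 (1 / x) + 1"
    unfolding j_def using l0 by linarith+
  have "1 / x = 2 powr log 2 (1 / x)" using assms by simp
  also have "\<dots> \<le> 2 powr real j" using j by (intro powr_mono) auto
  also have "\<dots> = 2 ^ j" by (simp add: powr_realpow)
  finally have jx: "1 / 2 ^ j \<le> x" using assms by (simp add: field_simps)
  have "D ^ j = D powr real j" using D_gt_1 by (simp add: powr_realpow)
  also have "\<dots> \<le> D powr (log 2 (1 / x) + 1)" using j D_gt_1 by (intro powr_mono) auto
  also have "\<dots> = D * D powr log 2 (1 / x)" using D_gt_1 by (simp add: powr_add)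
  also have "D powr log 2 (1 / x) = (1 / x) powr log 2 D"
    using assms D_gt_1 by (simp add: powr_def log_def)
  also have "(1 / x) powr log 2 D = 1 / x powr log 2 D"
    using assms by (simp add: powr_divide)
  finally have Dj: "D ^ j * x powr log 2 D \<le> D" using assms by (simp add: field_simps)
  have "1 = dilate F t 1" using assms F_pos[of t] by (simp add: dilate_def)
  also have "\<dots> \<le> D ^ j * dilate F t (1 / 2 ^ j)" using assms by (intro dilate_doubling_power) auto
  also have "\<dots> \<le> D ^ j * dilate F t x"
    using assms D_gt_1 jx by (intro mult_left_mono dilate_mono) auto
  finally have *: "1 \<le> D ^ j * dilate F t x" .
  have "x powr log 2 D * 1 \<le> x powr log 2 D * (D ^ j * dilate F t x)"
    using * by (intro mult_left_mono) auto
  also have "\<dots> = (D ^ j * x powr log 2 D) * dilate F t x" by simp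
  also have "\<dots> \<le> D * dilate F t x"
    using Dj dilate_pos[of t x] assms by (intro mult_right_mono) auto
  finally show ?thesis using D_gt_1 by (simp add: field_simps)
qed

text \<open>Of numerator and denominator in \<open>dilate\<close>, one is compared by monotonicity
  and the other by doubling, so each direction costs a single factor \<open>D\<close>.\<close>

lemma dilate_near:
  assumes "0 < s" "s \<le> t" "t \<le> 2 * s" "0 < x"
  shows "dilate F t x \<le> D * dilate F s x" "dilate F s x \<le> D * dilate F t x"
proof -
  have near: "F (s * y) \<le> F (t * y)" "F (t * y) \<le> D * F (s * y)" if "y > 0" for y
  proof -
    show "F (s * y) \<le> F (t * y)" using assms that by (intro F_mono) auto
    have "F (t * y) \<le> F (2 * (s * y))" using assms that by (intro F_mono) auto
    also have "\<dots> \<le> D * F (s * y)" using assms that by (intro doubling) auto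
    finally show "F (t * y) \<le> D * F (s * y)" .
  qed
  have "F (t * x) / F t \<le> (D * F (s * x)) / F s"
    using near[of x] near[of 1] assms F_pos[of s] F_pos[of "t * x"] by (intro frac_le) auto
  then show "dilate F t x \<le> D * dilate F s x" by (simp add: dilate_def)
  have "F (s * x) * F t \<le> F (t * x) * (D * F s)"
    using near[of x] near[of 1] assms F_pos[of t] F_pos[of "t * x"] by (intro mult_mono) auto
  then show "dilate F s x \<le> D * dilate F t x"
    using assms F_pos[of s] F_pos[of t] by (simp add: dilate_def field_simps)
qed

text \<open>The product of the quotients \<open>F (t * x ^ Suc i) / F (t * x ^ i)\<close>
  telescopes.\<close>

lemma dilate_power:
  assumes "0 < t" "0 < x"
  shows "dilate F t (x ^ m) = (\<Prod>i<m. dilate F (t * x ^ i) x)"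
proof (induction m)
  case 0
  then show ?case using assms F_pos[of t] by (simp add: dilate_def)
next
  case (Suc m)
  have "F (t * x ^ m) > 0" using assms by (intro F_pos) auto
  then have "dilate F t (x ^ Suc m) = dilate F t (x ^ m) * dilate F (t * x ^ m) x"
    by (simp add: dilate_def mult_ac)
  then show ?case using Suc by simp
qed

text \<open>Extends control from the points \<open>2 ^ (- m * j)\<close> to \<open>[0,1]\<close>.
  For \<open>x > 0\<close> there is a grid point \<open>y\<close> with
  \<open>y / 2 ^ m < x \<le> y\<close>. If there is a jump at \<open>y\<close>, convexity gives
  \<open>dilate F u x \<le> x \<le> y \<le> d\<close>; if not, the comparison at \<open>y\<close>
  carries over to \<open>x\<close> at the cost of \<open>D ^ m\<close>. Leaving \<open>u\<close> and
  \<open>v\<close> unordered covers rises and falls.\<close>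

lemma dilate_le_of_grid:
  assumes "m > 0" "u \<ge> 1" "v \<ge> 1" "K \<ge> 0" "d \<ge> 0" "0 \<le> x" "x \<le> 1"
    and grid: "\<And>j. K * dilate F v ((1 / 2 ^ j) ^ m) \<le> dilate F u ((1 / 2 ^ j) ^ m) \<Longrightarrow>
      (1 / 2 ^ j) ^ m \<le> d"
  shows "dilate F u x \<le> K * D ^ m * dilate F v x + d"
proof (cases "x = 0")
  case True
  then show ?thesis using assms by simp
next
  case False
  then have x: "0 < x" using assms by simp
  define P where "P i \<longleftrightarrow> (1 / 2 ^ Suc i :: real) ^ m < x" for i
  define j where "j = (LEAST i. P i)"
  obtain i where i: "(1 / 2 :: real) ^ i < x" using real_arch_pow_inv[of x "1/2"] x by auto
  have "(1 / 2 ^ Suc i :: real) ^ m \<le> (1 / 2 ^ Suc i) ^ 1"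
    using assms(1) one_le_power[of "2::real" "Suc i"]
    by (intro power_decreasing) (auto simp: divide_le_eq)
  also have "\<dots> \<le> (1 / 2) ^ i" by (simp add: field_simps)
  finally have "P i" unfolding P_def using i by simp
  then have Pj: "P j" unfolding j_def by (rule LeastI)
  have xj: "x \<le> (1 / 2 ^ j) ^ m"
  proof (cases j)
    case 0
    then show ?thesis using assms by simp
  next
    case (Suc i)
    then have "\<not> P i" unfolding j_def by (intro not_less_Least) simp
    then show ?thesis using Suc unfolding P_def by simp
  qed
  define y :: real where "y = (1 / 2 ^ j) ^ m"
  have y: "0 < y" unfolding y_def by simp
  have "y / 2 ^ m = (1 / 2 ^ Suc j) ^ m"
    unfolding y_def by (simp add: power_divide power_mult_distrib)
  then have yx: "y / 2 ^ m \<le> x" using Pj unfolding P_def by simp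
  show ?thesis
  proof (cases "K * dilate F v y \<le> dilate F u y")
    case True
    have "dilate F u x \<le> x" using assms by (intro dilate_le_self) auto
    also have "\<dots> \<le> d" using xj grid[of j] True unfolding y_def by simp
    finally show ?thesis
      using assms x D_gt_1 dilate_pos[of v x] by (simp add: add_increasing)
  next
    case False
    have "dilate F u x \<le> dilate F u y" using assms xj unfolding y_def by (intro dilate_mono) auto
    also have "\<dots> \<le> K * dilate F v y" using False by simp
    also have "\<dots> \<le> K * (D ^ m * dilate F v (y / 2 ^ m))"
      using assms y by (intro mult_left_mono dilate_doubling_power) auto
    also have "\<dots> \<le> K * (D ^ m * dilate F v x)"
      using assms y D_gt_1 yx by (intro mult_left_mono dilate_mono) auto
    finally show ?thesis using assms by simp
  qed
qed

section \<open>The equivalent conditions\<close>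

lemma elastic_iff: "elastic_at_infinity F \<longleftrightarrow>
    (\<exists>C0 C1 r. C0 > 1 \<and> C1 > 1 \<and> r > 0 \<and> (\<forall>x n. 0 < x \<and> x \<le> 1 \<longrightarrow>
       (rises C0 (\<lambda>t. dilate F t x) n \<longrightarrow> real n \<le> C1 * x powr (- r)) \<and>
       (rises C0 (\<lambda>t. inverse (dilate F t x)) n \<longrightarrow> real n \<le> C1 * x powr (- r))))"
  by (rule elastic_at_infinity_iff) (auto intro: dilate_pos)

text \<open>Both claims feed the jump bounds into \<open>multiplicative_potential\<close>, the
  second one with the reciprocal of \<open>dilate F\<close>, whose rises are the falls of
  \<open>dilate F\<close>. The increment of the potential then serves as \<open>d\<close> in
  \<open>dilate_le_of_grid\<close>.\<close>

lemma elastic_imp_potential: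
  assumes "elastic_at_infinity F"
  shows "\<exists>w C0. bounded (w ` {1..}) \<and> mono_on {1..} w \<and>
      (\<forall>s t x. 1 \<le> s \<and> s \<le> t \<and> 0 \<le> x \<and> x \<le> 1 \<longrightarrow>
        dilate F t x \<le> C0 * dilate F s x + w t - w s)"
    and "\<exists>w C0. bounded (w ` {1..}) \<and> mono_on {1..} w \<and>
      (\<forall>s t x. 1 \<le> s \<and> s \<le> t \<and> 0 \<le> x \<and> x \<le> 1 \<longrightarrow>
        dilate F s x \<le> C0 * dilate F t x + w t - w s)"
proof -
  obtain C0 C1 r where C: "C0 > 1" "C1 > 1" "r > 0"
    and le: "\<And>n x. 0 < x \<Longrightarrow> x \<le> 1 \<Longrightarrow> rises C0 (\<lambda>t. dilate F t x) n \<Longrightarrow> real n \<le> C1 * x powr (- r)"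
      "\<And>n x. 0 < x \<Longrightarrow> x \<le> 1 \<Longrightarrow> rises C0 (\<lambda>t. inverse (dilate F t x)) n \<Longrightarrow> real n \<le> C1 * x powr (- r)"
    using assms unfolding elastic_iff by blast
  have C1: "C1 > 0" using C by simp
  show "\<exists>w C0. bounded (w ` {1..}) \<and> mono_on {1..} w \<and>
      (\<forall>s t x. 1 \<le> s \<and> s \<le> t \<and> 0 \<le> x \<and> x \<le> 1 \<longrightarrow>
        dilate F t x \<le> C0 * dilate F s x + w t - w s)"
  proof (rule multiplicative_potential[where h = "dilate F" and D = D, OF C(1) C1 _ _ _ le(1)])
    fix m K and w :: "real \<Rightarrow> real"
    assume m: "m > 0" "K > (1::real)" and w: "bounded (w ` {1..})" "mono_on {1..} w"
      and jump: "\<And>j s t. 1 \<le> s \<Longrightarrow> s \<le> t \<Longrightarrow>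
        K * dilate F s ((1 / 2 ^ j) ^ m) \<le> dilate F t ((1 / 2 ^ j) ^ m) \<Longrightarrow> (1 / 2 ^ j) ^ m \<le> w t - w s"
    have "dilate F t x \<le> K * D ^ m * dilate F s x + (w t - w s)"
      if "1 \<le> s" "s \<le> t" "0 \<le> x" "x \<le> 1" for s t x
      using that m jump mono_onD[OF w(2), of s t] by (intro dilate_le_of_grid) auto
    then show ?thesis using w by (intro exI[of _ w] exI[of _ "K * D ^ m"]) (auto simp: add_diff_eq)
  qed (auto intro: dilate_pos dilate_power dilate_near)
  show "\<exists>w C0. bounded (w ` {1..}) \<and> mono_on {1..} w \<and>
      (\<forall>s t x. 1 \<le> s \<and> s \<le> t \<and> 0 \<le> x \<and> x \<le> 1 \<longrightarrow>
        dilate F s x \<le> C0 * dilate F t x + w t - w s)"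
  proof (rule multiplicative_potential[where h = "\<lambda>t x. inverse (dilate F t x)" and D = D,
        OF C(1) C1 _ _ _ le(2)])
    fix s t x :: real assume "0 < s" "s \<le> t" "t \<le> 2 * s" "0 < x"
    then show "inverse (dilate F t x) \<le> D * inverse (dilate F s x)"
      using dilate_near(2)[of s t x] dilate_pos[of s x] dilate_pos[of t x] by (simp add: field_simps)
  next
    fix m K and w :: "real \<Rightarrow> real"
    assume m: "m > 0" "K > (1::real)" and w: "bounded (w ` {1..})" "mono_on {1..} w"
      and jump: "\<And>j s t. 1 \<le> s \<Longrightarrow> s \<le> t \<Longrightarrow>
        K * inverse (dilate F s ((1 / 2 ^ j) ^ m)) \<le> inverse (dilate F t ((1 / 2 ^ j) ^ m)) \<Longrightarrow>
        (1 / 2 ^ j) ^ m \<le> w t - w s"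
    have "dilate F s x \<le> K * D ^ m * dilate F t x + (w t - w s)"
      if st: "1 \<le> s" "s \<le> t" "0 \<le> x" "x \<le> 1" for s t x
    proof (rule dilate_le_of_grid)
      fix j assume *: "K * dilate F t ((1 / 2 ^ j) ^ m) \<le> dilate F s ((1 / 2 ^ j) ^ m)"
      have "0 < dilate F s ((1 / 2 ^ j) ^ m)" "0 < dilate F t ((1 / 2 ^ j) ^ m)"
        using st by (auto intro!: dilate_pos)
      then show "(1 / 2 ^ j) ^ m \<le> w t - w s"
        using * by (intro jump st) (simp add: field_simps)
    qed (use st m mono_onD[OF w(2), of s t] in auto)
    then show ?thesis using w by (intro exI[of _ w] exI[of _ "K * D ^ m"]) (auto simp: add_diff_eq)
  qed (auto intro: dilate_pos simp: dilate_power prod_inversef[symmetric, unfolded o_def])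
qed

text \<open>\<open>falls_le_rises\<close>, applied to \<open>dilate F\<close> or to its reciprocal,
  transfers a bound on either count to the other one at the threshold \<open>K\<^sup>2\<close>. The
  given bound survives the passage from \<open>K\<close> to \<open>K\<^sup>2\<close> by
  \<open>rises_mono\<close>.\<close>

lemma elasticI:
  assumes "K > 1" "M > 0"
    and "(\<forall>x n. 0 < x \<and> x \<le> 1 \<and> rises K (\<lambda>t. dilate F t x) n \<longrightarrow>
           real n \<le> M * (D / x powr log 2 D)) \<or>
         (\<forall>x n. 0 < x \<and> x \<le> 1 \<and> rises K (\<lambda>t. inverse (dilate F t x)) n \<longrightarrow>
           real n \<le> M * (D / x powr log 2 D))"
  shows "elastic_at_infinity F"
proof -
  define q where "q = log 2 D"
  have q: "q > 0" unfolding q_def using D_gt_1 by simp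
  have K2: "K \<le> K\<^sup>2" "K\<^sup>2 > 1" using assms(1) by (auto simp: power2_eq_square less_1_mult)
  \<comment> \<open>The first two summands are the bounds for the given and for the transferred
    count, in units of \<open>x powr - (2 * q)\<close>; adding 1 makes \<open>C > 1\<close>.\<close>
  define C where "C = M * D\<^sup>2 + (M + 1) * D\<^sup>2 / ln K + 1"
  have lnK: "ln K > 0" using assms(1) by simp
  have C: "C > 1" unfolding C_def using assms D_gt_1 lnK
    by (simp add: add_pos_pos)
  have main: "real n \<le> C * x powr - (2 * q)"
    if x: "0 < x" "x \<le> 1" and n: "rises (K\<^sup>2) (\<lambda>t. dilate F t x) n \<or>
      rises (K\<^sup>2) (\<lambda>t. inverse (dilate F t x)) n" for x n
  proof -
    \<comment> \<open>The reciprocal of the lower bound in \<open>dilate_ge\<close>, so that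
      \<open>ln Z\<close> bounds the logarithmic range of \<open>dilate F t x\<close> and of its
      reciprocal over \<open>t \<ge> 1\<close>.\<close>
    define Z where "Z = D / x powr q"
    have "x powr q \<le> 1" using x q by (simp add: powr_le1)
    then have Z: "Z \<ge> 1" unfolding Z_def using x D_gt_1 by (simp add: field_simps)
    have Z2: "Z\<^sup>2 = D\<^sup>2 * x powr - (2 * q)"
    proof -
      have "(x powr q)\<^sup>2 = x powr (2 * q)" by (simp add: power2_eq_square flip: powr_add)
      then show ?thesis unfolding Z_def by (simp add: power_divide powr_minus_divide)
    qed
    have pos: "dilate F t x > 0" if "t \<ge> 1" for t using that x by (intro dilate_pos) auto
    have range: "inverse Z \<le> dilate F t x" "dilate F t x \<le> 1" if "t \<ge> 1" for t
      using dilate_ge[of t x] dilate_le_self[of t x] that x by (auto simp: Z_def q_def)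
    have range': "1 \<le> inverse (dilate F t x)" "inverse (dilate F t x) \<le> Z" if "t \<ge> 1" for t
      using range[OF that] pos[OF that] Z by (auto simp: field_simps)
    have "real n \<le> M * Z \<or> real n * ln K \<le> (M * Z + 1) * ln Z"
      using assms(3)
    proof (elim disjE)
      assume as: "\<forall>x n. 0 < x \<and> x \<le> 1 \<and> rises K (\<lambda>t. dilate F t x) n \<longrightarrow>
           real n \<le> M * (D / x powr log 2 D)"
      then have N: "real n \<le> M * Z" if "rises K (\<lambda>t. dilate F t x) n" for n
        using that x by (auto simp: Z_def q_def)
      show ?thesis using n
      proof
        assume "rises (K\<^sup>2) (\<lambda>t. dilate F t x) n"
        then have "rises K (\<lambda>t. dilate F t x) n" using K2(1) pos by (rule rises_mono)
        then show ?thesis using N by blast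
      next
        assume "rises (K\<^sup>2) (\<lambda>t. inverse (dilate F t x)) n"
        then have "real n * ln K \<le> (M * Z + 1) * ln (1 / inverse Z)"
          using Z range N assms(1) by (intro falls_le_rises[where g = "\<lambda>t. dilate F t x"]) auto
        moreover have "1 / inverse Z = Z" by (simp add: divide_inverse)
        ultimately show ?thesis by metis
      qed
    next
      assume as: "\<forall>x n. 0 < x \<and> x \<le> 1 \<and> rises K (\<lambda>t. inverse (dilate F t x)) n \<longrightarrow>
           real n \<le> M * (D / x powr log 2 D)"
      then have N: "real n \<le> M * Z" if "rises K (\<lambda>t. inverse (dilate F t x)) n" for n
        using that x by (auto simp: Z_def q_def)
      show ?thesis using n
      proof
        assume "rises (K\<^sup>2) (\<lambda>t. inverse (dilate F t x)) n"
        then have "rises K (\<lambda>t. inverse (dilate F t x)) n"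
          using K2(1) by (rule rises_mono) (simp add: pos)
        then show ?thesis using N by blast
      next
        assume "rises (K\<^sup>2) (\<lambda>t. dilate F t x) n"
        then have "real n * ln K \<le> (M * Z + 1) * ln (Z / 1)"
          using Z range' N assms(1)
          by (intro falls_le_rises[where g = "\<lambda>t. inverse (dilate F t x)"]) auto
        then show ?thesis by simp
      qed
    qed
    then have "real n \<le> M * Z\<^sup>2 + (M + 1) * Z\<^sup>2 / ln K"
    proof
      assume "real n \<le> M * Z"
      also have "M * Z \<le> M * Z\<^sup>2" using assms(2) Z by (intro mult_left_mono) (auto simp: power2_eq_square)
      finally show ?thesis using assms(2) lnK by (simp add: add_increasing2)
    next
      assume "real n * ln K \<le> (M * Z + 1) * ln Z"
      also have "\<dots> \<le> ((M + 1) * Z) * Z"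
        using Z assms(2) ln_le_minus_one[of Z] by (intro mult_mono) (auto simp: algebra_simps)
      finally have "real n \<le> (M + 1) * Z\<^sup>2 / ln K"
        using lnK by (simp add: field_simps power2_eq_square)
      then show ?thesis using assms(2) by (simp add: add_increasing)
    qed
    also have "\<dots> = (C - 1) * x powr - (2 * q)"
      unfolding Z2 C_def by (simp add: algebra_simps)
    also have "\<dots> \<le> C * x powr - (2 * q)" by (intro mult_right_mono) auto
    finally show ?thesis .
  qed
  show ?thesis unfolding elastic_iff
    using C K2(2) q main by (intro exI[of _ "K\<^sup>2"] exI[of _ C] exI[of _ "2 * q"]) auto
qed

text \<open>A jump by the factor \<open>2 * C0\<close> leaves at least half of
  \<open>dilate F (u k) x\<close> in its summand, and \<open>dilate_ge\<close> bounds that half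
  below by a power of \<open>x\<close>.\<close>

lemma interlaced_count_le:
  assumes "interlaced n a b" "0 < x" "x \<le> 1" "C0 > 0"
    and "\<And>k. k \<in> {1..n} \<Longrightarrow> 1 \<le> u k \<and> 2 * C0 * dilate F (v k) x \<le> dilate F (u k) x"
    and "(\<Sum>k=1..n. dilate F (u k) x - C0 * dilate F (v k) x) \<le> C1"
  shows "real n \<le> 2 * C1 * (D / x powr log 2 D)"
proof -
  have "(x powr log 2 D / D) / 2 \<le> dilate F (u k) x - C0 * dilate F (v k) x" if "k \<in> {1..n}" for k
    using assms(5)[OF that] dilate_ge[of "u k" x] assms(2,3) by simp
  then have "(\<Sum>k=1..n. (x powr log 2 D / D) / 2) \<le> (\<Sum>k=1..n. dilate F (u k) x - C0 * dilate F (v k) x)"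
    by (intro sum_mono)
  then have "real n * ((x powr log 2 D / D) / 2) \<le> C1" using assms(6) by simp
  then show ?thesis using D_gt_1 assms(2) by (simp add: field_simps)
qed

lemma sums_up_imp_elastic:
  assumes "C0 > 1" "C1 > 1"
    and sums: "\<And>n a b x. interlaced n a b \<Longrightarrow> 0 \<le> x \<Longrightarrow> x \<le> 1 \<Longrightarrow>
      (\<Sum>k=1..n. dilate F (b k) x - C0 * dilate F (a k) x) \<le> C1"
  shows "elastic_at_infinity F"
proof (rule elasticI[of "2 * C0" "2 * C1"])
  have "real n \<le> 2 * C1 * (D / x powr log 2 D)"
    if x: "0 < x" "x \<le> 1" and n: "rises (2 * C0) (\<lambda>t. dilate F t x) n" for x n
  proof -
    obtain a b where ab: "interlaced n a b"
      "\<And>k. k \<in> {1..n} \<Longrightarrow> 2 * C0 * dilate F (a k) x \<le> dilate F (b k) x"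
      using n unfolding rises_def by blast
    have "1 \<le> b k" if "k \<in> {1..n}" for k using ab(1) that by (force simp: interlaced_def)
    then show ?thesis using ab x assms(1) sums[OF ab(1), of x]
      by (intro interlaced_count_le[OF ab(1), where u = b and v = a and ?C0.0 = C0]) auto
  qed
  then show "(\<forall>x n. 0 < x \<and> x \<le> 1 \<and> rises (2 * C0) (\<lambda>t. dilate F t x) n \<longrightarrow>
           real n \<le> 2 * C1 * (D / x powr log 2 D)) \<or>
         (\<forall>x n. 0 < x \<and> x \<le> 1 \<and> rises (2 * C0) (\<lambda>t. inverse (dilate F t x)) n \<longrightarrow>
           real n \<le> 2 * C1 * (D / x powr log 2 D))" by blast
qed (use assms in auto)

lemma sums_down_imp_elastic:
  assumes "C0 > 1" "C1 > 1"
    and sums: "\<And>n a b x. interlaced n a b \<Longrightarrow> 0 \<le> x \<Longrightarrow> x \<le> 1 \<Longrightarrow>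
      (\<Sum>k=1..n. dilate F (a k) x - C0 * dilate F (b k) x) \<le> C1"
  shows "elastic_at_infinity F"
proof (rule elasticI[of "2 * C0" "2 * C1"])
  have "real n \<le> 2 * C1 * (D / x powr log 2 D)"
    if x: "0 < x" "x \<le> 1" and n: "rises (2 * C0) (\<lambda>t. inverse (dilate F t x)) n" for x n
  proof -
    obtain a b where ab: "interlaced n a b"
      "\<And>k. k \<in> {1..n} \<Longrightarrow> 2 * C0 * inverse (dilate F (a k) x) \<le> inverse (dilate F (b k) x)"
      using n unfolding rises_def by blast
    have "1 \<le> a k \<and> 2 * C0 * dilate F (b k) x \<le> dilate F (a k) x" if k: "k \<in> {1..n}" for k
    proof -
      have "1 \<le> a k" "a k < b k" using ab(1) k by (auto simp: interlaced_def)
      then have "0 < dilate F (a k) x" "0 < dilate F (b k) x" using x by (auto intro: dilate_pos)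
      then show ?thesis using ab(2)[OF k] \<open>1 \<le> a k\<close> by (simp add: field_simps)
    qed
    then show ?thesis using x assms(1) sums[OF ab(1), of x]
      by (intro interlaced_count_le[OF ab(1), where u = a and v = b and ?C0.0 = C0]) auto
  qed
  then show "(\<forall>x n. 0 < x \<and> x \<le> 1 \<and> rises (2 * C0) (\<lambda>t. dilate F t x) n \<longrightarrow>
           real n \<le> 2 * C1 * (D / x powr log 2 D)) \<or>
         (\<forall>x n. 0 < x \<and> x \<le> 1 \<and> rises (2 * C0) (\<lambda>t. inverse (dilate F t x)) n \<longrightarrow>
           real n \<le> 2 * C1 * (D / x powr log 2 D))" by blast
qed (use assms in auto)

text \<open>\<open>u\<close> and \<open>v\<close> pick an endpoint of each interval, so that both
  directions are instances. Raising \<open>C0\<close> to at least 2 is harmless as dilations are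
  nonnegative, and \<open>max M 1\<close> makes the final constant exceed 1.\<close>

lemma potential_imp_sums:
  fixes u v :: "real \<Rightarrow> real \<Rightarrow> real" and w :: "real \<Rightarrow> real"
  assumes w: "bounded (w ` {1..})" "mono_on {1..} w"
    and uv: "\<And>s t. 1 \<le> s \<Longrightarrow> s \<le> t \<Longrightarrow> 1 \<le> v s t"
    and le: "\<And>s t x. 1 \<le> s \<Longrightarrow> s \<le> t \<Longrightarrow> 0 \<le> x \<Longrightarrow> x \<le> 1 \<Longrightarrow>
      dilate F (u s t) x \<le> C0 * dilate F (v s t) x + w t - w s"
  shows "\<exists>C0 C1. C0 > 1 \<and> C1 > 1 \<and> (\<forall>n a b x. interlaced n a b \<and> 0 \<le> x \<and> x \<le> 1 \<longrightarrow>
      (\<Sum>k=1..n. dilate F (u (a k) (b k)) x - C0 * dilate F (v (a k) (b k)) x) \<le> C1)"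
proof -
  obtain M where M: "\<And>t. t \<ge> 1 \<Longrightarrow> \<bar>w t\<bar> \<le> M"
    using w(1) unfolding bounded_iff by auto
  have "(\<Sum>k=1..n. dilate F (u (a k) (b k)) x - max C0 2 * dilate F (v (a k) (b k)) x) \<le> 2 * max M 1"
    if ab: "interlaced n a b" and x: "0 \<le> x" "x \<le> 1" for n a b x
  proof (rule interlaced_sum_le[OF ab w(2)])
    fix k assume "k \<in> {1..n}"
    then have k: "1 \<le> a k" "a k \<le> b k" using ab by (auto simp: interlaced_def intro: less_imp_le)
    have "dilate F (v (a k) (b k)) x \<ge> 0"
      using uv[OF k] x dilate_mono[of "v (a k) (b k)" 0 x] by simp
    then have "C0 * dilate F (v (a k) (b k)) x \<le> max C0 2 * dilate F (v (a k) (b k)) x"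
      by (intro mult_right_mono) auto
    then show "dilate F (u (a k) (b k)) x - max C0 2 * dilate F (v (a k) (b k)) x \<le> w (b k) - w (a k)"
      using le[OF k x] by simp
  next
    fix t :: real assume "t \<ge> 1"
    then show "\<bar>w t\<bar> \<le> max M 1" using M[of t] by simp
  qed
  then show ?thesis by (intro exI[of _ "max C0 2"] exI[of _ "2 * max M 1"]) auto
qed

end

theorem proposition6p4:
  fixes F :: "real \<Rightarrow> real"
  assumes "orlicz_function F" and "Delta2_condition F"
  shows
    "(elastic_at_infinity F \<longleftrightarrow>
       (\<exists>C0 C1. C0 > 1 \<and> C1 > 1 \<and>
         (\<forall>n a b x. interlaced n a b \<and> 0 \<le> x \<and> x \<le> 1 \<longrightarrow>
           (\<Sum>k=1..n. dilate F (b k) x - C0 * dilate F (a k) x) \<le> C1))) \<and>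
     (elastic_at_infinity F \<longleftrightarrow>
       (\<exists>C0 C1. C0 > 1 \<and> C1 > 1 \<and>
         (\<forall>n a b x. interlaced n a b \<and> 0 \<le> x \<and> x \<le> 1 \<longrightarrow>
           (\<Sum>k=1..n. dilate F (a k) x - C0 * dilate F (b k) x) \<le> C1))) \<and>
     (elastic_at_infinity F \<longleftrightarrow>
       (\<exists>(w :: real \<Rightarrow> real) C0. bounded (w ` {1..}) \<and> mono_on {1..} w \<and>
         (\<forall>s t x. 1 \<le> s \<and> s \<le> t \<and> 0 \<le> x \<and> x \<le> 1 \<longrightarrow>
           dilate F t x \<le> C0 * dilate F s x + w t - w s))) \<and>
     (elastic_at_infinity F \<longleftrightarrow>
       (\<exists>(w :: real \<Rightarrow> real) C0. bounded (w ` {1..}) \<and> mono_on {1..} w \<and>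
         (\<forall>s t x. 1 \<le> s \<and> s \<le> t \<and> 0 \<le> x \<and> x \<le> 1 \<longrightarrow>
           dilate F s x \<le> C0 * dilate F t x + w t - w s)))"
    (is "(?E \<longleftrightarrow> ?S2) \<and> (_ \<longleftrightarrow> ?S3) \<and> (_ \<longleftrightarrow> ?S4) \<and> (_ \<longleftrightarrow> ?S5)")
proof -
  obtain D0 where D0: "\<And>x. x \<ge> 0 \<Longrightarrow> F (2 * x) \<le> D0 * F x"
    using assms(2) unfolding Delta2_condition_def by blast
  \<comment> \<open>Enlarging the constant keeps the doubling inequality since \<open>F\<close> is
    nonnegative, and it yields \<open>D > 1\<close>, hence a positive exponent
    \<open>log 2 D\<close>.\<close>
  interpret doubling_orlicz F "max D0 2"
  proof
    fix x :: real assume x: "x \<ge> 0"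
    have "F x \<ge> 0" using assms(1) x unfolding orlicz_function_def by auto
    then have "D0 * F x \<le> max D0 2 * F x" by (intro mult_right_mono) auto
    then show "F (2 * x) \<le> max D0 2 * F x" using D0[OF x] by simp
  qed (use assms in auto)
  \<comment> \<open>Two cycles of implications through \<open>?E\<close>: over \<open>?S4\<close>
    and \<open>?S2\<close> for rises, over \<open>?S5\<close> and \<open>?S3\<close> for
    falls.\<close>
  have "?E \<Longrightarrow> ?S4" "?E \<Longrightarrow> ?S5" by (fact elastic_imp_potential)+
  moreover have "?S4 \<Longrightarrow> ?S2"
    by (elim exE conjE, rule potential_imp_sums[where u = "\<lambda>s t. t" and v = "\<lambda>s t. s"]) auto
  moreover have "?S5 \<Longrightarrow> ?S3"
    by (elim exE conjE, rule potential_imp_sums[where u = "\<lambda>s t. s" and v = "\<lambda>s t. t"]) auto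
  moreover have "?S2 \<Longrightarrow> ?E" using sums_up_imp_elastic by blast
  moreover have "?S3 \<Longrightarrow> ?E" using sums_down_imp_elastic by blast
  ultimately show ?thesis by blast
qed

end
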